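(* Let $n$ be a natural number with $n\neq 2$ and $n\neq 6$. Then any alinear quasigroup over the symmetric group $S_n$ is not orthogonal to its $(12)$-parastrophe, not orthogonal to its $(13)$-parastrophe, and not orthogonal to its $(23)$-parastrophe.
   Context: An anti-automorphism of a group $(Q,+)$ (written additively, not necessarily commutative) is a permutation $\overline{\varphi}$ of $Q$ with $\overline{\varphi}(x+y)=\overline{\varphi}y+\overline{\varphi}x$ for all $x,y\in Q$. An alinear quasigroup over $(Q,+)$ is a quasigroup $(Q,A)$ of the form $A(x,y)=\overline{\varphi}x+a+\overline{\psi}y$ with $\overline{\varphi},\overline{\psi}$ anti-automorphisms of $(Q,+)$ and a fixed $a\in Q$ (equivalently, of the form $\overline{\varphi}x+\overline{\psi}'y+a$ with $\overline{\varphi},\overline{\psi}'$ anti-automorphisms). Here $(Q,+)$ is the symmetric group $S_n$. The parastrophes of $A$ in question are defined by $A(x_1,x_2)=x_3\Leftrightarrow A^{(12)}(x_2,x_1)=x_3\Leftrightarrow A^{(13)}(x_3,x_2)=x_1\Leftrightarrow A^{(23)}(x_1,x_3)=x_2$. Two quasigroup operations $A,B$ on $Q$ are orthogonal if for all $a,b\in Q$ the system $A(x,y)=a$, $B(x,y)=b$ has a unique solution $(x,y)\in Q\times Q$.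
   Formalization: The formal theorem assumes in addition n > 1: for n = 1 (or 0) the group S_n is trivial, its only operation is an alinear quasigroup orthogonal to each of its parastrophes, so the claim as worded fails there. *)

theory Defs
  imports "HOL-Algebra.Sym_Groups"
begin

text \<open>A binary operation on a carrier set Q is represented by a total HOL function; only its
  values on Q matter.\<close>

definition is_quasigroup :: "'a set \<Rightarrow> ('a \<Rightarrow> 'a \<Rightarrow> 'a) \<Rightarrow> bool" where
  "is_quasigroup Q A \<longleftrightarrow>
     (\<forall>x\<in>Q. \<forall>y\<in>Q. A x y \<in> Q) \<and>
     (\<forall>a\<in>Q. \<forall>b\<in>Q. \<exists>!x. x \<in> Q \<and> A x a = b) \<and>
     (\<forall>a\<in>Q. \<forall>b\<in>Q. \<exists>!y. y \<in> Q \<and> A a y = b)"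

definition anti_automorphism :: "('a, 'm) monoid_scheme \<Rightarrow> ('a \<Rightarrow> 'a) \<Rightarrow> bool" where
  "anti_automorphism G \<phi> \<longleftrightarrow>
     bij_betw \<phi> (carrier G) (carrier G) \<and>
     (\<forall>x\<in>carrier G. \<forall>y\<in>carrier G. \<phi> (x \<otimes>\<^bsub>G\<^esub> y) = \<phi> y \<otimes>\<^bsub>G\<^esub> \<phi> x)"

definition alinear_quasigroup :: "('a, 'm) monoid_scheme \<Rightarrow> ('a \<Rightarrow> 'a \<Rightarrow> 'a) \<Rightarrow> bool" where
  "alinear_quasigroup G A \<longleftrightarrow>
     is_quasigroup (carrier G) A \<and>
     (\<exists>\<phi> \<psi> a. anti_automorphism G \<phi> \<and> anti_automorphism G \<psi> \<and> a \<in> carrier G \<and>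
        (\<forall>x\<in>carrier G. \<forall>y\<in>carrier G. A x y = \<phi> x \<otimes>\<^bsub>G\<^esub> a \<otimes>\<^bsub>G\<^esub> \<psi> y))"

definition parastrophe12 :: "('a \<Rightarrow> 'a \<Rightarrow> 'a) \<Rightarrow> 'a \<Rightarrow> 'a \<Rightarrow> 'a" where
  "parastrophe12 A x y = A y x"

definition parastrophe13 :: "'a set \<Rightarrow> ('a \<Rightarrow> 'a \<Rightarrow> 'a) \<Rightarrow> 'a \<Rightarrow> 'a \<Rightarrow> 'a" where
  "parastrophe13 Q A z y = (THE x. x \<in> Q \<and> A x y = z)"

definition parastrophe23 :: "'a set \<Rightarrow> ('a \<Rightarrow> 'a \<Rightarrow> 'a) \<Rightarrow> 'a \<Rightarrow> 'a \<Rightarrow> 'a" where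
  "parastrophe23 Q A x z = (THE y. y \<in> Q \<and> A x y = z)"

text \<open>For a quasigroup the three operations satisfy (and, on Q, are determined by) the usual
  defining equivalences of parastrophes.\<close>

lemma parastrophe12_iff: "A x\<^sub>1 x\<^sub>2 = x\<^sub>3 \<longleftrightarrow> parastrophe12 A x\<^sub>2 x\<^sub>1 = x\<^sub>3"
  by (simp add: parastrophe12_def)

lemma parastrophe13_iff:
  assumes "is_quasigroup Q A" "x\<^sub>1 \<in> Q" "x\<^sub>2 \<in> Q" "x\<^sub>3 \<in> Q"
  shows "A x\<^sub>1 x\<^sub>2 = x\<^sub>3 \<longleftrightarrow> parastrophe13 Q A x\<^sub>3 x\<^sub>2 = x\<^sub>1"
proof -
  have ex: "\<exists>!x. x \<in> Q \<and> A x x\<^sub>2 = x\<^sub>3"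
    using assms by (simp add: is_quasigroup_def)
  show ?thesis
  proof
    assume "A x\<^sub>1 x\<^sub>2 = x\<^sub>3"
    then show "parastrophe13 Q A x\<^sub>3 x\<^sub>2 = x\<^sub>1"
      unfolding parastrophe13_def using the1_equality[OF ex] assms(2) by simp
  next
    assume "parastrophe13 Q A x\<^sub>3 x\<^sub>2 = x\<^sub>1"
    then show "A x\<^sub>1 x\<^sub>2 = x\<^sub>3"
      unfolding parastrophe13_def using theI'[OF ex] by simp
  qed
qed

lemma parastrophe23_iff:
  assumes "is_quasigroup Q A" "x\<^sub>1 \<in> Q" "x\<^sub>2 \<in> Q" "x\<^sub>3 \<in> Q"
  shows "A x\<^sub>1 x\<^sub>2 = x\<^sub>3 \<longleftrightarrow> parastrophe23 Q A x\<^sub>1 x\<^sub>3 = x\<^sub>2"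
proof -
  have ex: "\<exists>!y. y \<in> Q \<and> A x\<^sub>1 y = x\<^sub>3"
    using assms by (simp add: is_quasigroup_def)
  show ?thesis
  proof
    assume "A x\<^sub>1 x\<^sub>2 = x\<^sub>3"
    then show "parastrophe23 Q A x\<^sub>1 x\<^sub>3 = x\<^sub>2"
      unfolding parastrophe23_def using the1_equality[OF ex] assms(3) by simp
  next
    assume "parastrophe23 Q A x\<^sub>1 x\<^sub>3 = x\<^sub>2"
    then show "A x\<^sub>1 x\<^sub>2 = x\<^sub>3"
      unfolding parastrophe23_def using theI'[OF ex] by simp
  qed
qed

definition orthogonal_ops :: "'a set \<Rightarrow> ('a \<Rightarrow> 'a \<Rightarrow> 'a) \<Rightarrow> ('a \<Rightarrow> 'a \<Rightarrow> 'a) \<Rightarrow> bool" where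
  "orthogonal_ops Q A B \<longleftrightarrow>
     (\<forall>a\<in>Q. \<forall>b\<in>Q. \<exists>!(x, y). (x, y) \<in> Q \<times> Q \<and> A x y = a \<and> B x y = b)"

end

theory Submission
  imports Defs
begin

text \<open>Composing the sign with an anti-automorphism of the symmetric group gives a nontrivial
  character with values in {-1, 1}, and the sign is the only one. Hence the sign of A x y is the product of the
  signs of x, y and a, and the same then holds for each of the three parastrophes B. So A x y
  and B x y always have the same sign, and the system A x y = u, B x y = v has no solution when
  u and v have opposite signs.\<close>

text \<open>All transpositions are conjugate, so \<open>f\<close> takes a single value on them. They
  generate the symmetric group, so the value 1 would make \<open>f\<close> trivial, against
  \<open>f r \<noteq> 1\<close>. Hence the value is -1, and \<open>f\<close> agrees with
  \<open>sign\<close> on generators.\<close>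

lemma character_eq_sign:
  fixes f :: "('a \<Rightarrow> 'a) \<Rightarrow> int"
  assumes fin: "finite S"
    and mult: "\<And>p q. p permutes S \<Longrightarrow> q permutes S \<Longrightarrow> f (p \<circ> q) = f p * f q"
    and val: "\<And>p. p permutes S \<Longrightarrow> f p \<in> {-1, 1}"
    and nontrivial: "r permutes S" "f r \<noteq> 1"
    and p: "p permutes S"
  shows "f p = sign p"
proof -
  have f_id: "f id = 1"
    using mult[of id id] val[of id] by (auto simp: permutes_id)
  \<comment> \<open>Conjugating (b c) by (a b) gives (a c); the factor
    \<open>f (transpose a b)\<close> enters twice and its square is 1.\<close>
  have move: "f (transpose a c) = f (transpose b c)"
    if "a \<in> S" "b \<in> S" "c \<in> S" "a \<noteq> c" "b \<noteq> c" for a b c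
  proof -
    have ab: "transpose a b permutes S" and bc: "transpose b c permutes S"
      using that by (auto intro: permutes_swap_id)
    have "f (transpose a c) = f (transpose a b \<circ> transpose b c \<circ> transpose a b)"
      using that by (simp add: transpose_comp_triple)
    also have "\<dots> = f (transpose a b) * f (transpose b c) * f (transpose a b)"
      using ab bc by (simp add: mult permutes_compose)
    also have "\<dots> = f (transpose b c)"
      using val[OF ab] by auto
    finally show ?thesis .
  qed
  have same: "f (transpose a b) = f (transpose c d)"
    if "a \<in> S" "b \<in> S" "c \<in> S" "d \<in> S" "a \<noteq> b" "c \<noteq> d" for a b c d
  \<comment> \<open>Two applications of \<open>move\<close> lead from (a b) through (b c) to (c d).
    If c = b the middle term is no transposition, but then one application suffices.\<close>
  proof (cases "c = b")
    case True
    then show ?thesis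
      using that move[of a d b] by (simp add: transpose_commute)
  next
    case False
    then have "f (transpose a b) = f (transpose b c)"
      using that move[of a c b] by (simp add: transpose_commute)
    also have "\<dots> = f (transpose c d)"
      using False that move[of b d c] by (simp add: transpose_commute)
    finally show ?thesis .
  qed
  have transp: "f (transpose a b) = -1" if ab: "a \<in> S" "b \<in> S" "a \<noteq> b" for a b
  proof (rule ccontr)
    assume "f (transpose a b) \<noteq> -1"
    then have one: "f (transpose a b) = 1"
      using val[of "transpose a b"] ab by (auto intro: permutes_swap_id)
    \<comment> \<open>By \<open>same\<close>, every transposition now has value 1, and building
      \<open>r\<close> up from transpositions keeps this value.\<close>
    have "f r = 1"
      using nontrivial(1) fin
    proof (induction rule: permutes_induct)
      case id
      show ?case by (rule f_id)
    next
      case (swap c d q)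
      then show ?case
        using same[of c d a b] one ab mult[OF permutes_swap_id, of c d q] by (simp add: o_def)
    qed
    with nontrivial(2) show False ..
  qed
  show ?thesis
    using p fin
  proof (induction rule: permutes_induct)
    case id
    show ?case by (simp only: f_id sign_id)
  next
    case (swap a b q)
    then have "permutation q"
      using fin permutation_permutes by blast
    with swap have "f (transpose a b \<circ> q) = sign (transpose a b \<circ> q)"
      by (simp add: mult permutes_swap_id transp sign_compose permutation_swap_id sign_swap_id)
    then show ?case by (simp add: o_def)
  qed
qed

text \<open>Signs commute, so the reversal of products by \<phi> disappears and
  \<open>sign (\<phi> x)\<close> is multiplicative in x. It is nontrivial because \<phi> is onto and
  an odd permutation exists for n \<ge> 2; so \<open>character_eq_sign\<close> applies.\<close>

lemma sign_anti_automorphism: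
  assumes anti: "anti_automorphism (sym_group n) \<phi>"
    and n: "2 \<le> n" and p: "p \<in> carrier (sym_group n)"
  shows "sign (\<phi> p) = sign p"
proof -
  let ?Q = "carrier (sym_group n)"
  have bij: "bij_betw \<phi> ?Q ?Q"
    and rev: "\<And>x y. x \<in> ?Q \<Longrightarrow> y \<in> ?Q \<Longrightarrow> \<phi> (x \<circ> y) = \<phi> y \<circ> \<phi> x"
    using anti by (auto simp: anti_automorphism_def sym_group_mult)
  have in_Q: "\<phi> x \<in> ?Q" if "x \<in> ?Q" for x
    using bij_betwE[OF bij] that by blast
  have "- 1 \<in> sign ` ?Q"
    using sign_is_surj[OF n] by (simp add: sign_img_def)
  \<comment> \<open>Surjectivity lets the odd permutation be written as
    \<open>\<phi> r\<close>.\<close>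
  also have "?Q = \<phi> ` ?Q"
    using bij by (simp add: bij_betw_def)
  finally obtain r where r: "r \<in> ?Q" "sign (\<phi> r) = -1" by auto
  show ?thesis
  proof (rule character_eq_sign[of "{1..n}" "\<lambda>x. sign (\<phi> x)" r p])
    fix x y assume "x permutes {1..n}" "y permutes {1..n}"
    then have "x \<in> ?Q" "y \<in> ?Q" by (simp_all add: sym_group_carrier)
    then show "sign (\<phi> (x \<circ> y)) = sign (\<phi> x) * sign (\<phi> y)"
      by (simp add: rev sign_compose in_Q sym_group_carrier'[of _ n] mult.commute)
  qed (use r p in \<open>auto simp: sym_group_carrier sign_def\<close>)
qed

lemma not_orthogonal_if_invariant:
  assumes "\<And>x y. x \<in> Q \<Longrightarrow> y \<in> Q \<Longrightarrow> s (A x y) = s (B x y)"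
    and "u \<in> Q" "v \<in> Q" "s u \<noteq> s v"
  shows "\<not> orthogonal_ops Q A B"
proof
  assume "orthogonal_ops Q A B"
  then obtain x y where "x \<in> Q" "y \<in> Q" "A x y = u" "B x y = v"
    using assms(2,3) unfolding orthogonal_ops_def by blast
  with assms(1)[of x y] assms(4) show False by simp
qed

lemma parastrophe13_solves:
  assumes "is_quasigroup Q A" "z \<in> Q" "y \<in> Q"
  shows "parastrophe13 Q A z y \<in> Q \<and> A (parastrophe13 Q A z y) y = z"
  unfolding parastrophe13_def
  by (rule theI') (use assms in \<open>simp add: is_quasigroup_def\<close>)

lemma parastrophe23_solves:
  assumes "is_quasigroup Q A" "x \<in> Q" "z \<in> Q"
  shows "parastrophe23 Q A x z \<in> Q \<and> A x (parastrophe23 Q A x z) = z"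
  unfolding parastrophe23_def
  by (rule theI') (use assms in \<open>simp add: is_quasigroup_def\<close>)

theorem corollary52:
  fixes n :: nat and A :: "(nat \<Rightarrow> nat) \<Rightarrow> (nat \<Rightarrow> nat) \<Rightarrow> (nat \<Rightarrow> nat)"
  assumes "n > 1" and "n \<noteq> 2" and "n \<noteq> 6"
    and "alinear_quasigroup (sym_group n) A"
  shows "\<not> orthogonal_ops (carrier (sym_group n)) A (parastrophe12 A) \<and>
    \<not> orthogonal_ops (carrier (sym_group n)) A (parastrophe13 (carrier (sym_group n)) A) \<and>
    \<not> orthogonal_ops (carrier (sym_group n)) A (parastrophe23 (carrier (sym_group n)) A)"
proof -
  let ?Q = "carrier (sym_group n)"
  have n: "2 \<le> n" using assms(1) by simp
  obtain \<phi> \<psi> a where qg: "is_quasigroup ?Q A"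
    and anti: "anti_automorphism (sym_group n) \<phi>" "anti_automorphism (sym_group n) \<psi>"
    and a: "a \<in> ?Q"
    and A: "\<And>x y. x \<in> ?Q \<Longrightarrow> y \<in> ?Q \<Longrightarrow> A x y = \<phi> x \<circ> a \<circ> \<psi> y"
    using assms(4) unfolding alinear_quasigroup_def sym_group_mult by blast
  have perm: "permutation (\<phi> x)" "permutation (\<psi> x)" if "x \<in> ?Q" for x
    using anti that bij_betwE sym_group_carrier' unfolding anti_automorphism_def by metis+
  have sign_A: "sign (A x y) = sign x * sign a * sign y" if "x \<in> ?Q" "y \<in> ?Q" for x y
    using that a n anti perm
    by (simp add: A sign_compose permutation_compose sym_group_carrier'[of _ n] sign_anti_automorphism)
  have "-1 \<in> sign ` ?Q"
    using sign_is_surj[OF n] by (simp add: sign_img_def)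
  then obtain u where u: "u \<in> ?Q" "sign u = -1" by auto
  have v: "id \<in> ?Q" "sign u \<noteq> sign (id :: nat \<Rightarrow> nat)"
    using u by (auto simp: sym_group_carrier permutes_id sign_id)
  \<comment> \<open>The unsolvable system has an odd first value \<open>u\<close> and the even
    second value \<open>id\<close>. For each parastrophe only the agreement of signs remains to be
    shown.\<close>
  note not_orth = not_orthogonal_if_invariant[of ?Q sign, OF _ u(1) v]
  have s12: "sign (A x y) = sign (parastrophe12 A x y)" if "x \<in> ?Q" "y \<in> ?Q" for x y
    using that by (simp add: parastrophe12_def sign_A)
  have s13: "sign (A x y) = sign (parastrophe13 ?Q A x y)" if "x \<in> ?Q" "y \<in> ?Q" for x y
  proof -
    let ?w = "parastrophe13 ?Q A x y"
    have w: "?w \<in> ?Q" "A ?w y = x"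
      using parastrophe13_solves[OF qg that] by auto
    \<comment> \<open>Here x is the value attained at \<open>?w\<close> and y. Putting this
      expression for \<open>sign x\<close> into \<open>sign_A\<close> makes the signs of a and y
      occur squared, which leaves \<open>sign ?w\<close>.\<close>
    have "sign x = sign ?w * sign a * sign y"
      using sign_A[OF w(1) that(2)] w(2) by simp
    then have "sign (A x y) = sign ?w * (sign a * sign a) * (sign y * sign y)"
      using that by (simp only: sign_A ac_simps)
    then show ?thesis by simp
  qed
  have s23: "sign (A x y) = sign (parastrophe23 ?Q A x y)" if "x \<in> ?Q" "y \<in> ?Q" for x y
  proof -
    let ?w = "parastrophe23 ?Q A x y"
    have w: "?w \<in> ?Q" "A x ?w = y"
      using parastrophe23_solves[OF qg that] by auto
    \<comment> \<open>Mirror image of the previous case: now \<open>sign y\<close> is replaced, and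
      the signs of a and x cancel.\<close>
    have "sign y = sign x * sign a * sign ?w"
      using sign_A[OF that(1) w(1)] w(2) by simp
    then have "sign (A x y) = sign ?w * (sign a * sign a) * (sign x * sign x)"
      using that by (simp only: sign_A ac_simps)
    then show ?thesis by simp
  qed
  show ?thesis
    by (intro conjI not_orth s12 s13 s23)
qed

end
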